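(* There exists a string family on which $\ell_m = \Omega(\ell\log n/\log\log n)$, where $n$ is the length of the string.
   Context: A string family is an infinite set of finite strings of unbounded length; asymptotic notation on a family refers to strings $w$ of the family with $n=|w|\to\infty$ (with constants uniform over the family). $w[i:j]$ denotes the substring of $w$ from position $i$ to position $j$ (positions start at 1). L-systems: an L-system is a tuple $(\Sigma,\varphi,\tau,s,d,n)$, where $\Sigma$ is a finite alphabet, $\varphi:\Sigma^*\to\Sigma^*$ is a non-erasing monoid endomorphism (each rule $a\to\varphi(a)$, $a\in\Sigma$, has $|\varphi(a)|\ge 1$), $\tau:\Sigma^*\to\Sigma^*$ is a coding (a morphism with $|\tau(a)|=1$ for all $a\in\Sigma$), $s\in\Sigma^+$ is the axiom, and $d\ge 0$, $n\ge 1$ are integers. It generates the unique string $\tau(\varphi^d(s))[1:n]$ of length $n$. It is always assumed that $d=n^{O(1)}$ and $|\Sigma|=n^{O(1)}$ (each value fits in an $O(\log n)$-bit word). The size of the L-system is $\sum_{a\in\Sigma}|\varphi(a)|+|s|+|\Sigma|+2$. The measure $\ell(w)$ is the size of the smallest L-system generating $w$. An L-system is prolongable if there is a symbol $a$ such that $s=a$ and $\varphi(a)=ax$ with $x\neq\varepsilon$ (the empty string). $\ell_m(w)$ is the size of the smallest prolongable L-system generating $w$. *)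

theory Defs
  imports Complex_Main "HOL-Library.Landau_Symbols"
begin

text \<open>
  The endomorphism and the coding of an L-system are given by their values on letters; values
  outside the alphabet are irrelevant.
\<close>

record 'a lsystem =
  alphabet :: "'a set"
  rule :: "'a \<Rightarrow> 'a list"
  coding :: "'a \<Rightarrow> 'a"
  axm :: "'a list"
  depth :: nat
  len :: nat

definition morph :: "('a \<Rightarrow> 'a list) \<Rightarrow> 'a list \<Rightarrow> 'a list" where
  "morph f xs = concat (map f xs)"

definition is_lsystem :: "'a lsystem \<Rightarrow> bool" where
  "is_lsystem L \<longleftrightarrow>
     finite (alphabet L) \<and>
     (\<forall>a\<in>alphabet L. rule L a \<noteq> [] \<and> set (rule L a) \<subseteq> alphabet L) \<and>
     (\<forall>a\<in>alphabet L. coding L a \<in> alphabet L) \<and>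
     axm L \<noteq> [] \<and> set (axm L) \<subseteq> alphabet L \<and>
     len L \<ge> 1"

text \<open>
  The conjunct \<open>length w = len L\<close> excludes systems whose iterate is shorter than \<open>len L\<close>.
\<close>

definition generates :: "'a lsystem \<Rightarrow> 'a list \<Rightarrow> bool" where
  "generates L w \<longleftrightarrow>
     is_lsystem L \<and>
     w = take (len L) (map (coding L) ((morph (rule L) ^^ depth L) (axm L))) \<and>
     length w = len L"

definition lsize :: "'a lsystem \<Rightarrow> nat" where
  "lsize L = (\<Sum>a\<in>alphabet L. length (rule L a)) + length (axm L) + card (alphabet L) + 2"

definition prolongable :: "'a lsystem \<Rightarrow> bool" where
  "prolongable L \<longleftrightarrow> (\<exists>a x. axm L = [a] \<and> rule L a = a # x \<and> x \<noteq> [])"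

text \<open>
  The standing assumption that the depth and the alphabet size are \<open>n\<close> to the power \<open>O(1)\<close> only makes
  sense relative to an exponent; it is kept as a parameter \<open>c\<close> of both measures.
\<close>

definition poly_bounded :: "nat \<Rightarrow> 'a lsystem \<Rightarrow> bool" where
  "poly_bounded c L \<longleftrightarrow> depth L \<le> len L ^ c \<and> card (alphabet L) \<le> len L ^ c"

definition ell :: "nat \<Rightarrow> 'a list \<Rightarrow> nat" where
  "ell c w = (LEAST k. \<exists>L. generates L w \<and> poly_bounded c L \<and> lsize L = k)"

definition ell_m :: "nat \<Rightarrow> 'a list \<Rightarrow> nat" where
  "ell_m c w = (LEAST k. \<exists>L. generates L w \<and> poly_bounded c L \<and> prolongable L \<and> lsize L = k)"

text \<open>For \<open>c \<ge> 1\<close> and nonempty \<open>w\<close>, both minima range over nonempty sets.\<close>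

lemma ell_attained:
  assumes "c \<ge> 1" "w \<noteq> []"
  shows "\<exists>L. generates L w \<and> poly_bounded c L"
proof -
  let ?L = "\<lparr>alphabet = set w, rule = (\<lambda>a. [a]), coding = id, axm = w, depth = 0, len = length w\<rparr>"
  have "length w \<le> length w ^ c"
    using assms by (intro self_le_power) (auto simp: Suc_le_eq)
  then have "card (set w) \<le> length w ^ c"
    using card_length le_trans by blast
  then have "generates ?L w \<and> poly_bounded c ?L"
    using assms by (auto simp: generates_def is_lsystem_def poly_bounded_def Suc_le_eq)
  then show ?thesis by blast
qed

lemma ell_m_attained:
  assumes "c \<ge> 1" "w \<noteq> []"
  shows "\<exists>L. generates L w \<and> poly_bounded c L \<and> prolongable L"
proof -
  obtain a y where w: "w = a # y" using assms by (cases w) auto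
  have len: "length w \<le> length w ^ c"
    using assms by (intro self_le_power) (auto simp: Suc_le_eq)
  then have card: "card (set w) \<le> length w ^ c"
    using card_length le_trans by blast
  let ?L = "\<lparr>alphabet = set w, rule = (\<lambda>b. if b = a then (if y = [] then [a, a] else w) else [b]),
    coding = id, axm = [a], depth = 1, len = length w\<rparr>"
  have "generates ?L w \<and> poly_bounded c ?L \<and> prolongable ?L"
    using assms len card w
    by (auto simp: generates_def is_lsystem_def poly_bounded_def prolongable_def morph_def Suc_le_eq)
  then show ?thesis by blast
qed

definition string_family :: "'a list set \<Rightarrow> bool" where
  "string_family F \<longleftrightarrow> infinite F \<and> (\<forall>N. \<exists>w\<in>F. length w \<ge> N)"

text \<open>The filter of strings \<open>w \<in> F\<close> with \<open>length w\<close> tending to infinity.\<close>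

definition along :: "'a list set \<Rightarrow> 'a list filter" where
  "along F = inf (filtercomap length at_top) (principal F)"

lemma eventually_along:
  "eventually P (along F) \<longleftrightarrow> (\<exists>N. \<forall>w\<in>F. length w \<ge> N \<longrightarrow> P w)"
  unfolding along_def eventually_inf_principal eventually_filtercomap eventually_at_top_linorder
  by (metis (lifting))

end

theory Submission
  imports Defs
begin

text \<open>
  The rules \<open>2 \<rightarrow> 02\<close>, \<open>0 \<rightarrow> 0\<close>, \<open>1 \<rightarrow> 11\<close> with axiom \<open>21\<close> produce, by varying the depth \<open>d\<close> only,
  at least \<open>n/2\<close> distinct strings \<open>0\<^sup>d 2 1\<^sup>n\<^sup>-\<^sup>d\<^sup>-\<^sup>1\<close> of each length \<open>n\<close>, all with \<open>\<ell> = O(1)\<close>.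
  In a prolongable system the iterates of the axiom are prefixes of one another, so the depth carries
  no information about the generated string. Hence systems of size at most \<open>k\<close> generate at most
  \<open>k\<^bsup>O(k)\<^esup>\<close> strings of length \<open>n\<close> over a fixed alphabet. If \<open>k\<close> is a small multiple of
  \<open>log n / log log n\<close>, this is less than \<open>n/2\<close>, and one of the strings is missed.
\<close>

section \<open>Iterated morphisms\<close>

lemma morph_append: "morph r (xs @ ys) = morph r xs @ morph r ys"
  by (simp add: morph_def)

lemma morph_pow_append: "(morph r ^^ d) (xs @ ys) = (morph r ^^ d) xs @ (morph r ^^ d) ys"
  by (induction d) (simp_all add: morph_append)

lemma length_morph_ge:
  assumes "\<And>a. a \<in> A \<Longrightarrow> r a \<noteq> []" "set xs \<subseteq> A"
  shows "length xs \<le> length (morph r xs)"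
  using assms(2)
proof (induction xs)
  case (Cons a xs)
  then have "r a \<noteq> []" using assms(1) by simp
  then have "1 \<le> length (r a)" by (simp add: Suc_le_eq)
  then show ?case using Cons by (simp add: morph_def)
qed (simp add: morph_def)

lemma set_morph_pow_subset:
  assumes "\<And>a. a \<in> A \<Longrightarrow> set (r a) \<subseteq> A" "set xs \<subseteq> A"
  shows "set ((morph r ^^ d) xs) \<subseteq> A"
proof (induction d)
  case (Suc d)
  then show ?case using assms(1) by (fastforce simp: morph_def)
qed (simp add: assms)

lemma length_morph_pow_ge:
  assumes "\<And>a. a \<in> A \<Longrightarrow> r a \<noteq> [] \<and> set (r a) \<subseteq> A" "set xs \<subseteq> A"
  shows "length xs \<le> length ((morph r ^^ d) xs)"
proof (induction d)
  case (Suc d)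
  have "set ((morph r ^^ d) xs) \<subseteq> A"
    using assms by (intro set_morph_pow_subset) auto
  then have "length ((morph r ^^ d) xs) \<le> length (morph r ((morph r ^^ d) xs))"
    using assms(1) by (intro length_morph_ge) auto
  then show ?case using Suc by simp
qed simp

text \<open>Lets an arbitrary alphabet be replaced by an initial segment of the naturals before
  systems are counted.\<close>

lemma morph_pow_relabel:
  assumes "\<And>a. a \<in> A \<Longrightarrow> r' (h a) = map h (r a) \<and> set (r a) \<subseteq> A" "set xs \<subseteq> A"
  shows "(morph r' ^^ d) (map h xs) = map h ((morph r ^^ d) xs)"
proof (induction d)
  case (Suc d)
  have "set ((morph r ^^ d) xs) \<subseteq> A"
    using assms by (intro set_morph_pow_subset) auto
  then have "map (\<lambda>a. r' (h a)) ((morph r ^^ d) xs) = map (\<lambda>a. map h (r a)) ((morph r ^^ d) xs)"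
    using assms(1) by auto
  then have "morph r' (map h ((morph r ^^ d) xs)) = map h (morph r ((morph r ^^ d) xs))"
    by (simp only: morph_def map_concat map_map comp_def)
  then show ?case using Suc by simp
qed simp

section \<open>Iterates in a prolongable system\<close>

lemma prolongable_iterate_Suc:
  assumes "r a = a # x"
  shows "(morph r ^^ Suc d) [a] = (morph r ^^ d) [a] @ (morph r ^^ d) x"
proof -
  \<comment> \<open>Spending the extra application innermost, on the axiom, exposes the previous
    iterate as a prefix.\<close>
  have "(morph r ^^ Suc d) [a] = (morph r ^^ d) ([a] @ x)"
    using assms by (simp add: funpow_Suc_right morph_def del: funpow.simps)
  then show ?thesis by (simp only: morph_pow_append)
qed

lemma prolongable_iterate_mono:
  assumes "r a = a # x" "d \<le> e"
  shows "\<exists>y. (morph r ^^ e) [a] = (morph r ^^ d) [a] @ y"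
  using assms(2)
proof (induction e rule: dec_induct)
  case (step e)
  then show ?case
    using prolongable_iterate_Suc[of r a x e, OF assms(1)] by auto
qed simp

text \<open>Each step appends the iterate of \<open>x\<close>, which is nonempty because the rules
  erase nothing. Hence \<open>n\<close> steps suffice for a prefix of length
  \<open>n\<close>.\<close>

lemma prolongable_iterate_length:
  assumes "\<And>b. b \<in> A \<Longrightarrow> r b \<noteq> [] \<and> set (r b) \<subseteq> A" "a \<in> A" "r a = a # x" "x \<noteq> []"
  shows "d < length ((morph r ^^ d) [a])"
proof (induction d)
  case (Suc d)
  have "set x \<subseteq> A" using assms(1)[OF assms(2)] assms(3) by auto
  then have "length x \<le> length ((morph r ^^ d) x)"
    using assms(1) by (intro length_morph_pow_ge)
  moreover have "1 \<le> length x" using assms(4) by (simp add: Suc_le_eq)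
  ultimately show ?case
    using Suc by (simp only: prolongable_iterate_Suc[of r a x, OF assms(3)] length_append)
qed simp

text \<open>Both iterates are prefixes of the one at depth \<open>max d e\<close>. This is where the
  depth stops mattering.\<close>

lemma take_prolongable_iterate:
  assumes "r a = a # x" "n \<le> length ((morph r ^^ d) [a])" "n \<le> length ((morph r ^^ e) [a])"
  shows "take n ((morph r ^^ d) [a]) = take n ((morph r ^^ e) [a])"
proof -
  obtain y z where "(morph r ^^ (max d e)) [a] = (morph r ^^ d) [a] @ y"
    "(morph r ^^ (max d e)) [a] = (morph r ^^ e) [a] @ z"
    using prolongable_iterate_mono[of r a x, OF assms(1)] by (metis max.cobounded1 max.cobounded2)
  then show ?thesis
    using assms(2,3) by (metis append_Nil2 diff_is_0_eq take0 take_append)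
qed

section \<open>Counting the strings of small prolongable systems\<close>

lemma card_lists_length_le_bound:
  assumes "finite A"
  shows "card {xs. set xs \<subseteq> A \<and> length xs \<le> k} \<le> (card A + 1) ^ k"
proof -
  have "(\<Sum>i\<le>k. q ^ i) \<le> (q + 1) ^ k" for q :: nat
  proof (induction k)
    case (Suc k)
    have "q ^ Suc k \<le> q * (q + 1) ^ k" by (simp add: power_mono mult_le_mono)
    then have "(\<Sum>i\<le>Suc k. q ^ i) \<le> (q + 1) ^ k + q * (q + 1) ^ k"
      unfolding sum.atMost_Suc using Suc by (rule add_mono[rotated])
    then show ?case by simp
  qed simp
  then show ?thesis using card_lists_length_le[OF assms] by simp
qed

text \<open>Rule tables over letters below \<open>k\<close>. Bounding the total length, as
  \<open>lsize\<close> does, keeps the count at \<open>k\<close> to the power O(k); bounding each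
  rule separately would only give an exponent of order \<open>k\<close> squared.\<close>

definition rule_lists :: "nat \<Rightarrow> nat list list set" where
  "rule_lists k = {rs. length rs \<le> k \<and> length (concat rs) \<le> k \<and> set (concat rs) \<subseteq> {..<k}}"

text \<open>A list of lists is recovered from its concatenation and the list of block lengths. Each
  of these has at most \<open>k\<close> entries, with letters below \<open>k\<close> and lengths up
  to \<open>k\<close>.\<close>

lemma rule_lists_bound:
  "finite (rule_lists k)" "card (rule_lists k) \<le> (k + 1) ^ k * (k + 2) ^ k"
proof -
  let ?enc = "\<lambda>rs :: nat list list. (concat rs, map length rs)"
  let ?X = "{xs. set xs \<subseteq> {..<k} \<and> length xs \<le> k}"
  let ?Y = "{xs. set xs \<subseteq> {..k} \<and> length xs \<le> k}"
  have inj: "inj_on ?enc (rule_lists k)"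
  proof (rule inj_onI)
    fix xs ys :: "nat list list"
    assume "?enc xs = ?enc ys"
    then have eq: "concat xs = concat ys" "map length xs = map length ys" by auto
    then have len: "length xs = length ys" by (metis length_map)
    then have "\<forall>(x, y)\<in>set (zip xs ys). length x = length y"
      using eq(2) by (auto simp: set_zip) (metis nth_map)
    then show "xs = ys" using concat_injective eq(1) len by blast
  qed
  have "length x \<le> length (concat rs)" if "x \<in> set rs" for x and rs :: "nat list list"
    using that by (simp add: length_concat member_le_sum_list)
  then have "length x \<le> k" if "rs \<in> rule_lists k" "x \<in> set rs" for x rs
    using that unfolding rule_lists_def by (blast intro: le_trans)
  then have sub: "?enc ` rule_lists k \<subseteq> ?X \<times> ?Y"
    by (fastforce simp: rule_lists_def)
  have fin: "finite (?X \<times> ?Y)"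
    by (simp add: finite_lists_length_le)
  show "finite (rule_lists k)"
    using inj sub fin by (rule inj_on_finite)
  have "card (rule_lists k) \<le> card (?X \<times> ?Y)"
    using inj sub fin by (rule card_inj_on_le)
  also have "\<dots> \<le> (k + 1) ^ k * (k + 2) ^ k"
    using card_lists_length_le_bound[of "{..<k}" k] card_lists_length_le_bound[of "{..k}" k]
    by (simp add: card_cartesian_product mult_le_mono)
  finally show "card (rule_lists k) \<le> (k + 1) ^ k * (k + 2) ^ k" .
qed

text \<open>Iterating \<open>n\<close> times suffices for a prefix of length \<open>n\<close>, whatever the original depth was.\<close>

definition decode :: "nat \<Rightarrow> nat list list \<times> 'a list \<times> nat \<Rightarrow> 'a list" where
  "decode n = (\<lambda>(rs, cs, i). take n (map ((!) cs) ((morph ((!) rs) ^^ n) [i])))"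

text \<open>Renaming the letters to \<open>0..<m\<close> and iterating \<open>n\<close> times leaves
  only a rule table, a list of codes and the index of the axiom as data.\<close>

lemma prolongable_decode:
  fixes L :: "'a lsystem"
  assumes gen: "generates L w" and pro: "prolongable L" and size: "lsize L \<le> k" and A: "set w \<subseteq> A"
  shows "w \<in> decode (length w) ` (rule_lists k \<times> {cs. set cs \<subseteq> A \<and> length cs \<le> k} \<times> {..<k})"
proof -
  define n where "n = length w"
  define m where "m = card (alphabet L)"
  obtain a x where ax: "axm L = [a]" "rule L a = a # x" "x \<noteq> []"
    using pro unfolding prolongable_def by blast
  from gen have fin: "finite (alphabet L)"
    and rule: "\<And>b. b \<in> alphabet L \<Longrightarrow> rule L b \<noteq> [] \<and> set (rule L b) \<subseteq> alphabet L"
    and a: "a \<in> alphabet L" and n: "n \<ge> 1" "len L = n"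
    and w: "w = take n (map (coding L) ((morph (rule L) ^^ depth L) [a]))"
    unfolding generates_def is_lsystem_def n_def using ax by auto
  have len: "n < length ((morph (rule L) ^^ n) [a])"
    using prolongable_iterate_length[of "alphabet L" "rule L" a x, OF rule a ax(2,3)] .
  \<comment> \<open>The original iterate is long enough because \<open>generates\<close> demands
    \<open>length w = len L\<close>; so depths \<open>depth L\<close> and \<open>n\<close> share the
    prefix of length \<open>n\<close>.\<close>
  have "n \<le> length ((morph (rule L) ^^ depth L) [a])"
    using w n_def by (metis length_map length_take min.absorb_iff1 min.commute)
  then have w': "w = map (coding L) (take n ((morph (rule L) ^^ n) [a]))"
    using w take_prolongable_iterate[of "rule L" a, OF ax(2)] len by (metis less_imp_le take_map)
  obtain g where g: "bij_betw g {0..<m} (alphabet L)"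
    using ex_bij_betw_nat_finite[OF fin] m_def by blast
  define h where "h = the_inv_into {0..<m} g"
  have h: "h b < m" "g (h b) = b" if "b \<in> alphabet L" for b
    using that g unfolding h_def
    by (metis atLeastLessThan_iff bij_betwE bij_betw_the_inv_into)
      (metis that g f_the_inv_into_f_bij_betw)
  have gm: "g i \<in> alphabet L" if "i < m" for i
    using g that by (auto simp: bij_betw_def)
  define rs where "rs = map (\<lambda>i. map h (rule L (g i))) [0..<m]"
  \<comment> \<open>Letters coded outside \<open>A\<close> do not occur in \<open>w\<close>, so their code can be replaced by any element of \<open>A\<close>.\<close>
  define \<tau> where "\<tau> b = (if coding L b \<in> A then coding L b else hd w)" for b
  define cs where "cs = map (\<lambda>i. \<tau> (g i)) [0..<m]"
  have "length (concat rs) = (\<Sum>i\<in>{0..<m}. length (rule L (g i)))"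
    by (simp add: rs_def length_concat comp_def interv_sum_list_conv_sum_set_nat)
  also have "\<dots> = (\<Sum>b\<in>alphabet L. length (rule L b))"
    using g by (rule sum.reindex_bij_betw)
  finally have total: "length (concat rs) + m \<le> k"
    using size unfolding lsize_def m_def by linarith
  have "set (concat rs) \<subseteq> {..<m}"
    using rule h(1) gm by (fastforce simp: rs_def)
  then have "set (concat rs) \<subseteq> {..<k}"
    using total by (auto simp del: set_concat)
  then have rs: "rs \<in> rule_lists k"
    using total by (simp add: rule_lists_def rs_def)
  have "hd w \<in> A" using n A unfolding n_def by (cases w) auto
  then have cs: "set cs \<subseteq> A" "length cs \<le> k"
    using total by (auto simp: cs_def \<tau>_def)
  have i: "h a < k" using h(1)[OF a] total by linarith
  have iter: "(morph ((!) rs) ^^ n) (map h [a]) = map h ((morph (rule L) ^^ n) [a])"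
    using rule h a by (intro morph_pow_relabel[where A = "alphabet L"]) (auto simp: rs_def)
  have sub: "set ((morph (rule L) ^^ n) [a]) \<subseteq> alphabet L"
    using rule a by (intro set_morph_pow_subset) auto
  have "decode n (rs, cs, h a) = map (\<lambda>b. cs ! h b) (take n ((morph (rule L) ^^ n) [a]))"
    using iter by (simp add: decode_def comp_def take_map)
  also have "\<dots> = map \<tau> (take n ((morph (rule L) ^^ n) [a]))"
    using sub h by (auto simp: cs_def dest!: in_set_takeD)
  also have "\<dots> = map (coding L) (take n ((morph (rule L) ^^ n) [a]))"
    using A w' by (fastforce simp: \<tau>_def)
  also have "\<dots> = w" using w' ..
  finally show ?thesis using rs cs i unfolding n_def by (auto intro: image_eqI[OF sym])
qed

lemma card_prolongable_words:
  fixes A :: "'a set"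
  assumes "finite A"
    and W: "\<And>w. w \<in> W \<Longrightarrow> length w = n \<and> set w \<subseteq> A \<and>
      (\<exists>L. generates L w \<and> prolongable L \<and> lsize L \<le> k)"
  shows "card W \<le> (k + 1) ^ k * (k + 2) ^ k * (card A + 1) ^ k * k"
proof -
  let ?C = "{cs. set cs \<subseteq> A \<and> length cs \<le> k}"
  let ?D = "rule_lists k \<times> ?C \<times> {..<k}"
  have fin: "finite ?D"
    using rule_lists_bound(1) assms(1) by (simp add: finite_lists_length_le)
  have "W \<subseteq> decode n ` ?D"
    using W prolongable_decode by blast
  then have "card W \<le> card ?D"
    using fin by (rule surj_card_le[rotated])
  also have "\<dots> = card (rule_lists k) * card ?C * k"
    by (simp add: card_cartesian_product)
  also have "\<dots> \<le> (k + 1) ^ k * (k + 2) ^ k * (card A + 1) ^ k * k"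
    using rule_lists_bound(2) card_lists_length_le_bound[OF assms(1)] by (intro mult_le_mono) auto
  finally show ?thesis .
qed

section \<open>Strings with constant \<open>ell\<close>\<close>

definition marked :: "nat \<Rightarrow> nat \<Rightarrow> nat list" where
  "marked n d = replicate d 0 @ 2 # replicate (n - d - 1) 1"

definition marking_system :: "nat \<Rightarrow> nat \<Rightarrow> nat lsystem" where
  "marking_system n d = \<lparr>alphabet = {0, 1, 2},
     rule = (\<lambda>a. if a = 2 then [0, 2] else if a = 1 then [1, 1] else [a]),
     coding = id, axm = [2, 1], depth = d, len = n\<rparr>"

lemma length_marked [simp]: "d < n \<Longrightarrow> length (marked n d) = n"
  by (simp add: marked_def)

lemma marked_inj:
  assumes "marked n d = marked n e"
  shows "d = e"
proof -
  have "takeWhile (\<lambda>i. i = 0) (marked n d) = replicate d 0" for d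
    by (simp add: marked_def takeWhile_append)
  then show ?thesis using assms by (metis length_replicate)
qed

lemma marking_system_iterate:
  "(morph (rule (marking_system n d)) ^^ e) [2, 1] = replicate e 0 @ 2 # replicate (2 ^ e) 1"
proof (induction e)
  case (Suc e)
  have "concat (replicate j [b]) = replicate j b" for j and b :: nat
    by (induction j) auto
  moreover have "concat (replicate j [b, b]) = replicate (2 * j) b" for j and b :: nat
    by (induction j) auto
  ultimately show ?case
    using Suc by (simp add: marking_system_def morph_def) (simp flip: replicate_append_same)
qed simp

lemma marking_system_generates:
  assumes "d < n" "n \<le> 2 * d + 2"
  shows "generates (marking_system n d) (marked n d)"
proof -
  have "d < 2 ^ d" by simp
  \<comment> \<open>The assumption \<open>n \<le> 2 * d + 2\<close> leaves at most
    \<open>d + 1\<close> ones to supply, and doubling has produced \<open>2 ^ d\<close> of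
    them.\<close>
  then have "n - d - 1 \<le> 2 ^ d" using assms by linarith
  then have "marked n d = take n (replicate d 0 @ 2 # replicate (2 ^ d) 1)"
    using assms(1) by (simp add: marked_def take_Cons' min_def)
  then have "marked n d = take (len (marking_system n d)) (map (coding (marking_system n d))
      ((morph (rule (marking_system n d)) ^^ depth (marking_system n d)) (axm (marking_system n d))))"
    using marking_system_iterate[of d n d] by (simp add: marking_system_def)
  moreover have "is_lsystem (marking_system n d)"
    using assms(1) by (simp add: is_lsystem_def marking_system_def)
  moreover have "length (marked n d) = len (marking_system n d)"
    using assms(1) by (simp add: marking_system_def)
  ultimately show ?thesis unfolding generates_def by blast
qed

text \<open>The 12 is 5 for the rules, 2 for the axiom, 3 for the alphabet and the additive
  2.\<close>

lemma ell_marked_le: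
  assumes "d < n" "n \<le> 2 * d + 2" "3 \<le> n" "1 \<le> c"
  shows "ell c (marked n d) \<le> 12"
proof -
  have "n \<le> n ^ c" using assms by (intro self_le_power) auto
  then have "poly_bounded c (marking_system n d)"
    using assms by (simp add: poly_bounded_def marking_system_def)
  moreover have "lsize (marking_system n d) = 12"
    by (simp add: lsize_def marking_system_def)
  ultimately show ?thesis
    using marking_system_generates[OF assms(1,2)] unfolding ell_def by (blast intro: Least_le)
qed

text \<open>The bound \<open>b\<close> is required of all prolongable systems, polynomially bounded
  or not, so it can be chosen independently of \<open>c\<close>.\<close>

lemma ell_m_ge:
  assumes "c \<ge> 1" "w \<noteq> []" "\<And>L. generates L w \<Longrightarrow> prolongable L \<Longrightarrow> b \<le> real (lsize L)"
  shows "b \<le> real (ell_m c w)"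
proof -
  have "\<exists>k L. generates L w \<and> poly_bounded c L \<and> prolongable L \<and> lsize L = k"
    using ell_m_attained[OF assms(1,2)] by blast
  then have "\<exists>L. generates L w \<and> poly_bounded c L \<and> prolongable L \<and> lsize L = ell_m c w"
    unfolding ell_m_def by (rule LeastI_ex)
  then show ?thesis using assms(3) by metis
qed

section \<open>The size threshold and the pigeonhole argument\<close>

definition size_bound :: "nat \<Rightarrow> real" where
  "size_bound n = log 2 (real n) / (8 * log 2 (log 2 (real n)))"

text \<open>With \<open>l = log 2 n\<close>, the count is at most
  \<open>(k + 3) ^ (4 * k) \<le> l ^ (4 * k)\<close>. The factor 8 in \<open>size_bound\<close>
  makes this at most \<open>2 powr (l / 2)\<close>, the square root of \<open>n\<close>, which is
  below \<open>n / 2\<close> once \<open>n > 4\<close>.\<close>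

lemma prolongable_count_lt:
  assumes "16 \<le> n" "real k \<le> size_bound n"
  shows "real ((k + 1) ^ k * (k + 2) ^ k * 4 ^ k * k) < real n / 2"
proof -
  define l where "l = log 2 (real n)"
  have l: "4 \<le> l"
    using assms(1) by (simp add: l_def le_log_iff)
  then have ll: "2 \<le> log 2 l"
    by (simp add: le_log_iff)
  have kl: "4 * real k * log 2 l \<le> l / 2"
    using assms(2) ll unfolding size_bound_def l_def[symmetric] by (simp add: field_simps)
  moreover have "4 * real k * 2 \<le> 4 * real k * log 2 l"
    using ll by (intro mult_left_mono) auto
  ultimately have k3: "real k + 3 \<le> l" using l by linarith
  have "(k + 1) ^ k * (k + 2) ^ k * 4 ^ k * k \<le> (k + 3) ^ (4 * k)"
  \<comment> \<open>For positive \<open>k\<close> each of the four factors is at most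
    \<open>(k + 3) ^ k\<close>; for \<open>k = 0\<close> the product vanishes.\<close>
  proof (cases "k = 0")
    case False
    have "(k + 1) ^ k * (k + 2) ^ k * 4 ^ k * k \<le> (k + 3) ^ k * (k + 3) ^ k * (k + 3) ^ k * (k + 3) ^ k"
      using False self_le_power[of "k + 3" k] by (intro mult_le_mono power_mono) auto
    also have "\<dots> = (k + 3) ^ (4 * k)" by (simp flip: power_add add: algebra_simps)
    finally show ?thesis .
  qed simp
  then have "real ((k + 1) ^ k * (k + 2) ^ k * 4 ^ k * k) \<le> real ((k + 3) ^ (4 * k))"
    by (rule of_nat_mono)
  also have "\<dots> = (real k + 3) ^ (4 * k)" by simp
  also have "\<dots> \<le> l ^ (4 * k)"
    using k3 by (intro power_mono) auto
  also have "\<dots> = 2 powr (4 * real k * log 2 l)"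
    using l powr_powr[of 2 "log 2 l" "4 * real k"] powr_realpow[of l "4 * k"]
    by (simp add: mult.commute)
  also have "\<dots> \<le> 2 powr (l / 2)"
    using kl by simp
  also have "\<dots> = sqrt (real n)"
    using assms(1) powr_powr[of 2 l "1 / 2"] by (simp add: l_def powr_half_sqrt)
  also have "\<dots> < real n / 2"
    using assms(1) by (intro real_less_lsqrt) (auto simp: power2_eq_square)
  finally show ?thesis .
qed

lemma ex_marked_hard:
  assumes "16 \<le> n"
  shows "\<exists>d. d < n \<and> n \<le> 2 * d + 2 \<and>
    (\<forall>L. generates L (marked n d) \<longrightarrow> prolongable L \<longrightarrow> size_bound n \<le> real (lsize L))"
proof (rule ccontr)
  assume neg: "\<not> ?thesis"
  define k where "k = nat \<lfloor>size_bound n\<rfloor>"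
  \<comment> \<open>Starting at \<open>n div 2\<close> guarantees \<open>n \<le> 2 * d + 2\<close>
    and still leaves at least \<open>n / 2\<close> strings.\<close>
  let ?W = "marked n ` {n div 2..<n}"
  have W: "length w = n \<and> set w \<subseteq> {0, 1, 2} \<and>
      (\<exists>L. generates L w \<and> prolongable L \<and> lsize L \<le> k)" if "w \<in> ?W" for w
  proof -
    obtain d where d: "w = marked n d" "d \<in> {n div 2..<n}"
      using \<open>w \<in> ?W\<close> by blast
    then have d_bounds: "d < n" "n \<le> 2 * d + 2" by auto
    then obtain L where L: "generates L w" "prolongable L" "real (lsize L) < size_bound n"
      using neg d by fastforce
    then have "lsize L \<le> k" unfolding k_def by (simp add: le_nat_floor)
    moreover have "length w = n \<and> set w \<subseteq> {0, 1, 2}"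
      using d(1) d_bounds by (auto simp: marked_def)
    ultimately show ?thesis using L by blast
  qed
  have "card ?W = n - n div 2"
    using marked_inj by (subst card_image) (auto intro: inj_onI)
  then have "real n / 2 \<le> real (card ?W)" by linarith
  also have "\<dots> \<le> real ((k + 1) ^ k * (k + 2) ^ k * 4 ^ k * k)"
    using card_prolongable_words[of "{0, 1, 2}" ?W n k, OF _ W] by (intro of_nat_mono) (simp add: numeral_eq_Suc)
  also have "\<dots> < real n / 2"
  proof (rule prolongable_count_lt[OF assms])
    have "real 1 \<le> log 2 (log 2 (real n))"
      using assms by (simp add: le_log_iff)
    moreover have "0 \<le> log 2 (real n)"
      using assms by simp
    ultimately have "0 \<le> size_bound n" by (simp add: size_bound_def)
    then show "real k \<le> size_bound n" unfolding k_def by linarith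
  qed
  finally show False by simp
qed

theorem lemma6:
  "\<exists>F :: nat list set. string_family F \<and>
     (\<forall>c\<ge>1. (\<lambda>w. real (ell_m c w)) \<in> \<Omega>[along F](\<lambda>w.
        real (ell c w) * log 2 (real (length w)) / log 2 (log 2 (real (length w)))))"
proof -
  \<comment> \<open>Hardness is stated without \<open>c\<close>, so one family serves every
    exponent.\<close>
  define F where "F = {marked n d | n d. 16 \<le> n \<and> d < n \<and> n \<le> 2 * d + 2 \<and>
    (\<forall>L. generates L (marked n d) \<longrightarrow> prolongable L \<longrightarrow> size_bound n \<le> real (lsize L))}"
  have long: "\<exists>w\<in>F. length w \<ge> N" for N
  proof -
    have ge: "16 \<le> max N 16" by simp
    obtain d where "d < max N 16" "marked (max N 16) d \<in> F"
      using ex_marked_hard[OF ge] ge unfolding F_def by blast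
    then show ?thesis by (metis length_marked max.cobounded1)
  qed
  have "infinite F"
  proof
    assume "finite F"
    then have "\<forall>w\<in>F. length w \<le> Max (length ` F)" by simp
    then show False using long[of "Suc (Max (length ` F))"] by fastforce
  qed
  then have "string_family F" using long by (simp add: string_family_def)
  moreover have "(\<lambda>w. real (ell_m c w)) \<in> \<Omega>[along F](\<lambda>w.
        real (ell c w) * log 2 (real (length w)) / log 2 (log 2 (real (length w))))"
    if c: "c \<ge> 1" for c
  \<comment> \<open>96 is 12 * 8: the bound on \<open>ell\<close> times the constant in
    \<open>size_bound\<close>.\<close>
  proof (rule landau_omega.bigI[of "1 / 96"])
    have "1 / 96 * norm (real (ell c w) * log 2 (real (length w)) / log 2 (log 2 (real (length w))))
        \<le> norm (real (ell_m c w))" if w: "w \<in> F" for w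
    proof -
      obtain n d where nd: "w = marked n d" "16 \<le> n" "d < n" "n \<le> 2 * d + 2"
        and hard: "\<And>L. generates L w \<Longrightarrow> prolongable L \<Longrightarrow> size_bound n \<le> real (lsize L)"
        using w unfolding F_def by blast
      have n: "length w = n" using nd by simp
      have l: "1 \<le> log 2 (real n)" "0 \<le> log 2 (log 2 (real n))"
        using nd(2) by (simp_all add: le_log_iff)
      have "ell c w \<le> 12" using ell_marked_le nd c by simp
      then have "real (ell c w) / 12 * size_bound n \<le> 1 * size_bound n"
        using l by (intro mult_right_mono) (auto simp: size_bound_def)
      also have "1 * size_bound n \<le> real (ell_m c w)"
      proof -
        have "w \<noteq> []" using nd(1) by (simp add: marked_def)
        then have "size_bound n \<le> real (ell_m c w)"
          using c hard nd(1) by (intro ell_m_ge) simp_all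
        then show ?thesis by simp
      qed
      finally show ?thesis
        using l by (simp add: n size_bound_def abs_mult)
    qed
    then show "eventually (\<lambda>w. norm (real (ell_m c w)) \<ge> 1 / 96 *
        norm (real (ell c w) * log 2 (real (length w)) / log 2 (log 2 (real (length w))))) (along F)"
      unfolding eventually_along by blast
  qed simp
  ultimately show ?thesis by blast
qed

end
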